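(* The following are equivalent: (1) Every Toeplitz operator $T_\phi$ with $0\ne\phi\in L^\infty[0,1]$ satisfies the Feichtinger Conjecture. (2) For every measurable set $E\subset[0,1]$ with $0<|E|$, the Toeplitz operator $P_E$ satisfies the Feichtinger Conjecture. (3) For every measurable set $E\subset[0,1]$ with $0<|E|$ there is a finite partition $\{A_j\}_{j=1}^r$ of $\mathbb Z$ such that for all $j=1,2,\dots,r$, $P_E$ is an isomorphism of $S(A_j)$ onto its range.
   Context: For $\phi\in L^\infty([0,1])$ the Toeplitz operator $T_\phi:L^2[0,1]\to L^2[0,1]$ is multiplication by $\phi$: $T_\phi f=f\cdot\phi$. For measurable $E\subset[0,1]$, $P_E=T_{\chi_E}$, i.e. $P_Ef=f\cdot\chi_E$. For $I\subset\mathbb Z$, $S(I)$ is the $L^2([0,1])$-closure of the span of $\{e^{2\pi int}\}_{n\in I}$. "Isomorphism onto its range" means a bounded linear map that is bounded below. A family $\{f_i\}_{i\in I}$ in a Hilbert space is a Riesz basic sequence if there are constants $A,B>0$ such that $A\sum|a_i|^2\le\|\sum a_if_i\|^2\le B\sum|a_i|^2$ for all scalars $\{a_i\}_{i\in I}$. $T_\phi$ satisfies the Feichtinger Conjecture if there is a finite partition $\{A_j\}_{j=1}^r$ of $\mathbb Z$ such that $\{T_\phi e^{2\pi int}\}_{n\in A_j}$ is a Riesz basic sequence for every $j=1,\dots,r$. *)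

theory Defs
  imports "HOL-Analysis.Analysis"
begin

section \<open>The Hilbert space of square-integrable functions on the unit interval\<close>

abbreviation unit_leb :: "real measure" where
  "unit_leb \<equiv> lebesgue_on {0..1}"

definition square_integrable :: "(real \<Rightarrow> complex) \<Rightarrow> bool" where
  "square_integrable f \<longleftrightarrow>
     f \<in> borel_measurable unit_leb \<and> integrable unit_leb (\<lambda>t. (cmod (f t))\<^sup>2)"

lemma square_integrable_bound:
  assumes g: "g \<in> borel_measurable unit_leb"
    and h: "integrable unit_leb h"
    and le: "AE t in unit_leb. (cmod (g t))\<^sup>2 \<le> h t"
  shows "square_integrable g"
  unfolding square_integrable_def
proof (intro conjI)
  show "integrable unit_leb (\<lambda>t. (cmod (g t))\<^sup>2)"
  proof (rule Bochner_Integration.integrable_bound[OF h])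
    show "(\<lambda>t. (cmod (g t))\<^sup>2) \<in> borel_measurable unit_leb" using g by measurable
    show "AE t in unit_leb. norm ((cmod (g t))\<^sup>2) \<le> norm (h t)" using le by eventually_elim auto
  qed
qed (fact g)

lemma square_integrable_zero: "square_integrable (\<lambda>t. 0)"
  by (simp add: square_integrable_def)

lemma square_integrable_mult_const:
  assumes "square_integrable f"
  shows "square_integrable (\<lambda>t. c * f t)"
  using assms by (auto simp: square_integrable_def norm_mult power_mult_distrib)

lemma square_integrable_add:
  assumes "square_integrable f" "square_integrable g"
  shows "square_integrable (\<lambda>t. f t + g t)"
proof (rule square_integrable_bound)
  show "(\<lambda>t. f t + g t) \<in> borel_measurable unit_leb"
    using assms by (auto simp: square_integrable_def)
  show "integrable unit_leb (\<lambda>t. 2 * (cmod (f t))\<^sup>2 + 2 * (cmod (g t))\<^sup>2)"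
    using assms by (auto simp: square_integrable_def)
  have "(cmod (x + y))\<^sup>2 \<le> 2 * (cmod x)\<^sup>2 + 2 * (cmod y)\<^sup>2" for x y :: complex
  proof -
    have "(cmod (x + y))\<^sup>2 \<le> (cmod x + cmod y)\<^sup>2"
      by (intro power_mono norm_triangle_ineq) auto
    also have "\<dots> \<le> 2 * (cmod x)\<^sup>2 + 2 * (cmod y)\<^sup>2"
      using sum_squares_bound[of "cmod x" "cmod y"] by (simp add: power2_sum)
    finally show ?thesis .
  qed
  then show "AE t in unit_leb. (cmod (f t + g t))\<^sup>2 \<le> 2 * (cmod (f t))\<^sup>2 + 2 * (cmod (g t))\<^sup>2"
    by auto
qed

lemma integrable_mult_cnj:
  assumes "square_integrable f" "square_integrable g"
  shows "integrable unit_leb (\<lambda>t. f t * cnj (g t))"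
proof (rule Bochner_Integration.integrable_bound)
  show "integrable unit_leb (\<lambda>t. (cmod (f t))\<^sup>2 + (cmod (g t))\<^sup>2)"
    using assms by (auto simp: square_integrable_def)
  show "(\<lambda>t. f t * cnj (g t)) \<in> borel_measurable unit_leb"
  proof -
    have "(\<lambda>t. cnj (g t)) \<in> borel_measurable unit_leb"
      using assms by (auto simp: square_integrable_def complex_eq_iff borel_measurable_complex_iff)
    then show ?thesis using assms by (auto simp: square_integrable_def)
  qed
  have "cmod (x * cnj y) \<le> norm ((cmod x)\<^sup>2 + (cmod y)\<^sup>2)" for x y :: complex
  proof -
    have "cmod x * cmod y \<le> 2 * cmod x * cmod y" by simp
    also have "\<dots> \<le> (cmod x)\<^sup>2 + (cmod y)\<^sup>2" by (rule sum_squares_bound)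
    finally show ?thesis by (simp add: norm_mult)
  qed
  then show "AE t in unit_leb. norm (f t * cnj (g t)) \<le> norm ((cmod (f t))\<^sup>2 + (cmod (g t))\<^sup>2)"
    by auto
qed

definition L2_rel :: "(real \<Rightarrow> complex) \<Rightarrow> (real \<Rightarrow> complex) \<Rightarrow> bool" where
  "L2_rel f g \<longleftrightarrow>
     square_integrable f \<and> square_integrable g \<and> (AE t in unit_leb. f t = g t)"

quotient_type L2 = "real \<Rightarrow> complex" / partial: L2_rel
proof (rule part_equivpI)
  show "\<exists>f. L2_rel f f"
    by (rule exI[of _ "\<lambda>t. 0"]) (simp add: L2_rel_def square_integrable_zero)
  show "symp L2_rel"
    by (auto simp: symp_def L2_rel_def elim: eventually_mono)
  show "transp L2_rel"
  proof (rule transpI)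
    fix f g h assume a: "L2_rel f g" "L2_rel g h"
    then have "AE t in unit_leb. f t = g t" "AE t in unit_leb. g t = h t"
      by (auto simp: L2_rel_def)
    then have "AE t in unit_leb. f t = h t" by eventually_elim simp
    with a show "L2_rel f h" by (auto simp: L2_rel_def)
  qed
qed

text \<open>A real inner product, the real part of \<open>\<integral> f \<cdot> cnj g\<close>, provides the norm, the metric and
  the topology; the complex vector space structure is given separately by \<open>scaleC\<close> below.\<close>

instantiation L2 :: real_inner
begin

lift_definition zero_L2 :: L2 is "\<lambda>t. 0"
  by (simp add: L2_rel_def square_integrable_zero)

lift_definition plus_L2 :: "L2 \<Rightarrow> L2 \<Rightarrow> L2" is "\<lambda>f g t. f t + g t"
  unfolding L2_rel_def
  by (intro conjI square_integrable_add; (elim conjE)?; assumption?)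
     (auto elim: eventually_elim2)

lift_definition uminus_L2 :: "L2 \<Rightarrow> L2" is "\<lambda>f t. - f t"
  unfolding L2_rel_def using square_integrable_mult_const[where c = "-1"]
  by (auto elim: eventually_mono)

definition minus_L2 :: "L2 \<Rightarrow> L2 \<Rightarrow> L2" where
  "minus_L2 f g = f + - g"

lift_definition scaleR_L2 :: "real \<Rightarrow> L2 \<Rightarrow> L2" is "\<lambda>r f t. of_real r * f t"
  unfolding L2_rel_def using square_integrable_mult_const
  by (auto elim: eventually_mono)

lift_definition inner_L2 :: "L2 \<Rightarrow> L2 \<Rightarrow> real" is
  "\<lambda>f g. Re (\<integral>t. f t * cnj (g t) \<partial>unit_leb)"
proof -
  fix f f' g g' assume a: "L2_rel f f'" "L2_rel g g'"
  then have "AE t in unit_leb. f t = f' t" "AE t in unit_leb. g t = g' t"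
    by (auto simp: L2_rel_def)
  then have ae: "AE t in unit_leb. f t * cnj (g t) = f' t * cnj (g' t)"
    by eventually_elim simp
  have "(\<integral>t. f t * cnj (g t) \<partial>unit_leb) = (\<integral>t. f' t * cnj (g' t) \<partial>unit_leb)"
    using a ae by (intro integral_cong_AE borel_measurable_integrable integrable_mult_cnj)
      (auto simp: L2_rel_def)
  then show "Re (\<integral>t. f t * cnj (g t) \<partial>unit_leb) = Re (\<integral>t. f' t * cnj (g' t) \<partial>unit_leb)"
    by simp
qed

lift_definition norm_L2 :: "L2 \<Rightarrow> real" is
  "\<lambda>f. sqrt (\<integral>t. (cmod (f t))\<^sup>2 \<partial>unit_leb)"
proof -
  fix f g assume a: "L2_rel f g"
  then have "AE t in unit_leb. f t = g t" by (auto simp: L2_rel_def)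
  then have "AE t in unit_leb. (cmod (f t))\<^sup>2 = (cmod (g t))\<^sup>2"
    by eventually_elim simp
  then have "(\<integral>t. (cmod (f t))\<^sup>2 \<partial>unit_leb) = (\<integral>t. (cmod (g t))\<^sup>2 \<partial>unit_leb)"
    using a by (intro integral_cong_AE) (auto simp: L2_rel_def square_integrable_def)
  then show "sqrt (\<integral>t. (cmod (f t))\<^sup>2 \<partial>unit_leb) = sqrt (\<integral>t. (cmod (g t))\<^sup>2 \<partial>unit_leb)"
    by simp
qed

definition sgn_L2 :: "L2 \<Rightarrow> L2" where
  "sgn_L2 f = scaleR (inverse (norm f)) f"

definition dist_L2 :: "L2 \<Rightarrow> L2 \<Rightarrow> real" where
  "dist_L2 f g = norm (f - g)"

definition uniformity_L2 :: "(L2 \<times> L2) filter" where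
  "uniformity_L2 = (INF e\<in>{0<..}. principal {(f, g). dist f g < e})"

definition open_L2 :: "L2 set \<Rightarrow> bool" where
  "open_L2 U \<longleftrightarrow> (\<forall>f\<in>U. eventually (\<lambda>(f', g). f' = f \<longrightarrow> g \<in> U) uniformity)"

instance
proof
  fix f g h :: L2 and r s :: real and U :: "L2 set"
  show "f + g + h = f + (g + h)"
    by transfer (auto simp: L2_rel_def add.assoc intro!: square_integrable_add)
  show "f + g = g + f"
    by transfer (auto simp: L2_rel_def add.commute intro!: square_integrable_add)
  show "0 + f = f"
    by transfer (auto simp: L2_rel_def)
  show "- f + f = 0"
    by transfer (auto simp: L2_rel_def square_integrable_zero)
  show "f - g = f + - g"
    by (rule minus_L2_def)
  show "r *\<^sub>R (f + g) = r *\<^sub>R f + r *\<^sub>R g"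
    by transfer (auto simp: L2_rel_def distrib_left
        intro!: square_integrable_add square_integrable_mult_const)
  show "(r + s) *\<^sub>R f = r *\<^sub>R f + s *\<^sub>R f"
    by transfer (auto simp: L2_rel_def distrib_right
        intro!: square_integrable_add square_integrable_mult_const)
  show "r *\<^sub>R s *\<^sub>R f = (r * s) *\<^sub>R f"
    by transfer (auto simp: L2_rel_def mult.assoc intro!: square_integrable_mult_const)
  show "1 *\<^sub>R f = f"
    by transfer (auto simp: L2_rel_def)
  show "sgn f = scaleR (inverse (norm f)) f"
    by (rule sgn_L2_def)
  show "dist f g = norm (f - g)"
    by (rule dist_L2_def)
  show "uniformity = (INF e\<in>{0<..}. principal {(f::L2, g). dist f g < e})"
    by (rule uniformity_L2_def)
  show "open U \<longleftrightarrow> (\<forall>f\<in>U. eventually (\<lambda>(f', g). f' = f \<longrightarrow> g \<in> U) uniformity)"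
    by (rule open_L2_def)
  show "inner f g = inner g f"
  proof transfer
    fix f g assume a: "L2_rel f f" "L2_rel g g"
    have "(\<integral>t. g t * cnj (f t) \<partial>unit_leb) = (\<integral>t. cnj (f t * cnj (g t)) \<partial>unit_leb)"
      by (simp add: mult.commute)
    also have "\<dots> = cnj (\<integral>t. f t * cnj (g t) \<partial>unit_leb)"
      using a by (intro integral_bounded_linear bounded_linear_cnj integrable_mult_cnj) (auto simp: L2_rel_def)
    finally show "Re (\<integral>t. f t * cnj (g t) \<partial>unit_leb) = Re (\<integral>t. g t * cnj (f t) \<partial>unit_leb)"
      by simp
  qed
  show "inner (f + g) h = inner f h + inner g h"
    by transfer (simp add: L2_rel_def distrib_right integrable_mult_cnj)
  show "inner (r *\<^sub>R f) g = r * inner f g"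
    by transfer (simp add: L2_rel_def mult.assoc)
  have sq: "Re (\<integral>t. f t * cnj (f t) \<partial>unit_leb) = (\<integral>t. (cmod (f t))\<^sup>2 \<partial>unit_leb)" for f
    by (simp only: complex_norm_square[symmetric] integral_complex_of_real Re_complex_of_real)
  show "0 \<le> inner f f"
    by transfer (simp add: sq)
  show "norm f = sqrt (inner f f)"
    by transfer (simp add: sq)
  show "inner f f = 0 \<longleftrightarrow> f = 0"
    by transfer (simp add: sq, auto simp: L2_rel_def square_integrable_def
        integral_nonneg_eq_0_iff_AE)
qed

end

lift_definition scaleC :: "complex \<Rightarrow> L2 \<Rightarrow> L2" (infixr "*\<^sub>C" 75) is "\<lambda>c f t. c * f t"
  unfolding L2_rel_def using square_integrable_mult_const
  by (auto elim: eventually_mono)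

interpretation L2: vector_space scaleC
proof
  fix c d :: complex and f g :: L2
  show "c *\<^sub>C (f + g) = c *\<^sub>C f + c *\<^sub>C g"
    by transfer (auto simp: L2_rel_def distrib_left
        intro!: square_integrable_add square_integrable_mult_const)
  show "(c + d) *\<^sub>C f = c *\<^sub>C f + d *\<^sub>C f"
    by transfer (auto simp: L2_rel_def distrib_right
        intro!: square_integrable_add square_integrable_mult_const)
  show "c *\<^sub>C d *\<^sub>C f = (c * d) *\<^sub>C f"
    by transfer (auto simp: L2_rel_def mult.assoc intro!: square_integrable_mult_const)
  show "1 *\<^sub>C f = f"
    by transfer (auto simp: L2_rel_def)
qed

section \<open>Toeplitz operators\<close>

definition Linf :: "(real \<Rightarrow> complex) set" where
  "Linf = {\<phi> \<in> borel_measurable unit_leb. \<exists>C. AE t in unit_leb. cmod (\<phi> t) \<le> C}"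

lemma square_integrable_Linf_mult:
  assumes "\<phi> \<in> Linf" "square_integrable f"
  shows "square_integrable (\<lambda>t. f t * \<phi> t)"
proof -
  obtain C where "AE t in unit_leb. cmod (\<phi> t) \<le> C" using assms by (auto simp: Linf_def)
  then have "AE t in unit_leb. (cmod (f t * \<phi> t))\<^sup>2 \<le> C\<^sup>2 * (cmod (f t))\<^sup>2"
  proof eventually_elim
    fix t assume "cmod (\<phi> t) \<le> C"
    then have "(cmod (\<phi> t))\<^sup>2 \<le> C\<^sup>2" by (intro power_mono) auto
    then show "(cmod (f t * \<phi> t))\<^sup>2 \<le> C\<^sup>2 * (cmod (f t))\<^sup>2"
      using mult_right_mono[of "(cmod (\<phi> t))\<^sup>2" "C\<^sup>2" "(cmod (f t))\<^sup>2"]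
      by (simp add: norm_mult power_mult_distrib mult.commute)
  qed
  then show ?thesis
    using assms by (intro square_integrable_bound) (auto simp: Linf_def square_integrable_def)
qed

text \<open>Multiplication by \<open>\<phi>\<close>; only symbols in \<open>Linf\<close> are meaningful, and any other symbol is sent
  to the zero operator to keep the function total.\<close>

lift_definition toeplitz :: "(real \<Rightarrow> complex) \<Rightarrow> L2 \<Rightarrow> L2" is
  "\<lambda>\<phi> f t. if \<phi> \<in> Linf then f t * \<phi> t else 0"
proof -
  fix \<phi> f g assume a: "L2_rel f g"
  show "L2_rel (\<lambda>t. if \<phi> \<in> Linf then f t * \<phi> t else 0) (\<lambda>t. if \<phi> \<in> Linf then g t * \<phi> t else 0)"
  proof (cases "\<phi> \<in> Linf")
    case True
    have "AE t in unit_leb. f t = g t" using a by (auto simp: L2_rel_def)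
    then have "AE t in unit_leb. f t * \<phi> t = g t * \<phi> t" by eventually_elim simp
    with True a show ?thesis by (auto simp: L2_rel_def square_integrable_Linf_mult)
  qed (simp add: L2_rel_def square_integrable_zero)
qed

definition proj :: "real set \<Rightarrow> L2 \<Rightarrow> L2" where
  "proj E = toeplitz (indicator E)"

lift_definition expo :: "int \<Rightarrow> L2" is
  "\<lambda>n t. exp (2 * of_real pi * \<i> * of_int n * of_real t)"
proof -
  fix n :: int
  let ?e = "\<lambda>t::real. exp (2 * of_real pi * \<i> * of_int n * of_real t)"
  have "continuous_on {0..1} ?e"
    by (intro continuous_intros)
  then have "?e \<in> borel_measurable unit_leb"
    by (intro continuous_imp_measurable_on_sets_lebesgue) auto
  moreover have "integrable unit_leb (\<lambda>t. (cmod (?e t))\<^sup>2)"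
    by (simp add: norm_exp_eq_Re integrable_restrict_space)
  ultimately show "L2_rel ?e ?e"
    by (auto simp: L2_rel_def square_integrable_def)
qed

definition exp_space :: "int set \<Rightarrow> L2 set" where
  "exp_space I = closure (L2.span (expo ` I))"

section \<open>Riesz basic sequences and the Feichtinger Conjecture\<close>

text \<open>The scalar families are the square-summable ones, for which the quantities in the two
  inequalities are finite. The series is required to converge (unconditionally) in norm, since
  the library's infinite sum is \<open>0\<close> by convention otherwise.\<close>

definition riesz_basic_sequence :: "'i set \<Rightarrow> ('i \<Rightarrow> L2) \<Rightarrow> bool" where
  "riesz_basic_sequence I f \<longleftrightarrow>
     (\<exists>A>0. \<exists>B>0. \<forall>a :: 'i \<Rightarrow> complex. (\<lambda>i. (cmod (a i))\<^sup>2) summable_on I \<longrightarrow>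
        (\<lambda>i. a i *\<^sub>C f i) summable_on I \<and>
        A * (\<Sum>\<^sub>\<infinity>i\<in>I. (cmod (a i))\<^sup>2) \<le> (norm (\<Sum>\<^sub>\<infinity>i\<in>I. a i *\<^sub>C f i))\<^sup>2 \<and>
        (norm (\<Sum>\<^sub>\<infinity>i\<in>I. a i *\<^sub>C f i))\<^sup>2 \<le> B * (\<Sum>\<^sub>\<infinity>i\<in>I. (cmod (a i))\<^sup>2))"

definition feichtinger :: "(L2 \<Rightarrow> L2) \<Rightarrow> bool" where
  "feichtinger T \<longleftrightarrow>
     (\<exists>\<A>. finite \<A> \<and> partition_on (UNIV :: int set) \<A> \<and>
        (\<forall>A\<in>\<A>. riesz_basic_sequence A (\<lambda>n. T (expo n))))"

definition isomorphism_onto_range :: "L2 set \<Rightarrow> (L2 \<Rightarrow> L2) \<Rightarrow> bool" where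
  "isomorphism_onto_range V T \<longleftrightarrow>
     (\<forall>f\<in>V. \<forall>g\<in>V. T (f + g) = T f + T g) \<and>
     (\<forall>c. \<forall>f\<in>V. T (c *\<^sub>C f) = c *\<^sub>C T f) \<and>
     (\<exists>C. \<forall>f\<in>V. norm (T f) \<le> C * norm f) \<and>
     (\<exists>c>0. \<forall>f\<in>V. c * norm f \<le> norm (T f))"

end

theory Submission
  imports Defs
begin

text \<open>All three conditions speak about one quantity: whether \<open>T\<^sub>\<phi>\<close> is bounded below on the
  spaces \<open>S(A)\<close> for the blocks \<open>A\<close> of a finite partition of the integers.

  The exponentials are orthonormal, so for square-summable \<open>a\<close> the series \<open>\<Sum> a\<^sub>n e\<^sub>n\<close>
  converges to some \<open>x \<in> S(A)\<close> with \<open>\<parallel>x\<parallel>\<^sup>2 = \<Sum> \<bar>a\<^sub>n\<bar>\<^sup>2\<close>, and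
  \<open>\<Sum> a\<^sub>n T\<^sub>\<phi> e\<^sub>n = T\<^sub>\<phi> x\<close> because \<open>T\<^sub>\<phi>\<close> is bounded. The Riesz inequalities for
  \<open>T\<^sub>\<phi> e\<^sub>n\<close>, \<open>n \<in> A\<close>, thus compare \<open>\<parallel>T\<^sub>\<phi> x\<parallel>\<close> with \<open>\<parallel>x\<parallel>\<close>; the upper one is
  boundedness, and the lower one says exactly that \<open>T\<^sub>\<phi>\<close> is bounded below on \<open>S(A)\<close>, since the
  finite sums are dense there (\<open>feichtinger_toeplitz_iff\<close>). As \<open>T\<^sub>\<phi>\<close> is linear and bounded
  in any case, being an isomorphism of \<open>S(A)\<close> onto its range means the same. This settles the
  equivalence of the two conditions on projections \<open>P\<^sub>E\<close>.

  The Feichtinger property of \<open>P\<^sub>E\<close> is the case \<open>\<phi> = \<chi>\<^sub>E\<close> of that of \<open>T\<^sub>\<phi>\<close>. Conversely, a symbol \<open>\<phi>\<close> that is not almost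
  everywhere zero satisfies \<open>\<bar>\<phi>\<bar> \<ge> \<epsilon>\<close> on a set \<open>E\<close> of positive measure for some
  \<open>\<epsilon> > 0\<close>, so \<open>\<parallel>T\<^sub>\<phi> f\<parallel> \<ge> \<epsilon> \<parallel>P\<^sub>E f\<parallel>\<close> for all \<open>f\<close>, and lower bounds for \<open>P\<^sub>E\<close> on the
  blocks of a partition pass to \<open>T\<^sub>\<phi>\<close> on the same blocks (\<open>feichtinger_toeplitz_mono\<close>).

  The convergence of \<open>\<Sum> a\<^sub>n e\<^sub>n\<close> rests on the completeness of \<open>L\<^sup>2\<close>, which is
  established first.\<close>

section \<open>Completeness of the space of square-integrable functions\<close>


lemma L2_cases:
  obtains f where "X = abs_L2 f" "square_integrable f"
proof
  have "L2_rel (rep_L2 X) (rep_L2 X)"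
    using Quotient3_L2 by (rule Quotient3_rep_reflp)
  then show "square_integrable (rep_L2 X)"
    by (simp add: L2_rel_def)
  show "X = abs_L2 (rep_L2 X)"
    using Quotient3_abs_rep[OF Quotient3_L2] by metis
qed

lemma L2_rel_refl_iff: "L2_rel f f \<longleftrightarrow> square_integrable f"
  by (simp add: L2_rel_def)

lemma square_integrable_diff:
  assumes "square_integrable f" "square_integrable g"
  shows "square_integrable (\<lambda>t. f t - g t)"
  using square_integrable_add[OF assms(1) square_integrable_mult_const[OF assms(2), of "-1"]]
  by simp

lemma abs_L2_diff:
  assumes "square_integrable f" "square_integrable g"
  shows "abs_L2 f - abs_L2 g = abs_L2 (\<lambda>t. f t - g t)"
  using assms square_integrable_mult_const[of g "-1"]
  by (simp add: minus_L2_def plus_L2.abs_eq uminus_L2.abs_eq L2_rel_refl_iff)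

lemma norm_abs_L2:
  assumes "square_integrable f"
  shows "(norm (abs_L2 f))\<^sup>2 = (\<integral>t. (cmod (f t))\<^sup>2 \<partial>unit_leb)"
  using assms by (simp add: norm_L2.abs_eq L2_rel_refl_iff)

lemma nn_integral_norm_abs_L2:
  assumes "square_integrable f"
  shows "(\<integral>\<^sup>+t. ennreal ((cmod (f t))\<^sup>2) \<partial>unit_leb) = ennreal ((norm (abs_L2 f))\<^sup>2)"
  using assms by (simp add: norm_abs_L2 nn_integral_eq_integral square_integrable_def)

lemma square_integrable_iff_nn_integral:
  "square_integrable f \<longleftrightarrow> f \<in> borel_measurable unit_leb \<and>
     (\<integral>\<^sup>+t. ennreal ((cmod (f t))\<^sup>2) \<partial>unit_leb) < \<infinity>"
  unfolding square_integrable_def by (auto simp: integrable_iff_bounded)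

lemma emeasure_unit_leb: "emeasure unit_leb (space unit_leb) = 1"
  by (simp add: emeasure_restrict_space)

text \<open>On a probability space the \<open>L\<^sup>1\<close> norm is at most the \<open>L\<^sup>2\<close> norm. This follows by integrating
  the pointwise estimate \<open>z \<le> \<delta> / 2 + z\<^sup>2 / (2 \<delta>)\<close>, an equality at \<open>z = \<delta>\<close>.\<close>
lemma nn_integral_norm_le:
  assumes f: "square_integrable f" and le: "norm (abs_L2 f) \<le> \<delta>" and "\<delta> > 0"
  shows "(\<integral>\<^sup>+t. ennreal (cmod (f t)) \<partial>unit_leb) \<le> ennreal \<delta>"
proof -
  have [measurable]: "f \<in> borel_measurable unit_leb"
    using f by (simp add: square_integrable_def)
  have "z \<le> \<delta> / 2 + z\<^sup>2 / (2 * \<delta>)" for z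
    using sum_squares_bound[of z \<delta>] \<open>\<delta> > 0\<close> by (simp add: field_simps power2_eq_square)
  then have "(\<integral>\<^sup>+t. ennreal (cmod (f t)) \<partial>unit_leb)
      \<le> (\<integral>\<^sup>+t. ennreal (\<delta> / 2) + ennreal (1 / (2 * \<delta>)) * ennreal ((cmod (f t))\<^sup>2) \<partial>unit_leb)"
    using \<open>\<delta> > 0\<close> by (intro nn_integral_mono) (simp flip: ennreal_plus ennreal_mult)
  also have "\<dots> = ennreal (\<delta> / 2) + ennreal (1 / (2 * \<delta>)) * ennreal ((norm (abs_L2 f))\<^sup>2)"
    by (subst nn_integral_add, measurable, subst nn_integral_cmult, measurable)
      (simp only: nn_integral_const emeasure_unit_leb nn_integral_norm_abs_L2[OF f] mult_1_right)
  also have "\<dots> \<le> ennreal (\<delta> / 2) + ennreal (1 / (2 * \<delta>)) * ennreal (\<delta>\<^sup>2)"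
    using le by (intro add_left_mono mult_left_mono ennreal_leI power_mono) auto
  also have "\<dots> = ennreal \<delta>"
    using \<open>\<delta> > 0\<close> by (simp flip: ennreal_plus ennreal_mult add: power2_eq_square)
  finally show ?thesis .
qed

text \<open>The integral of \<open>\<Sum> \<bar>u\<^sub>k\<bar>\<close> is at most \<open>\<Sum> 2\<^sup>-\<^sup>k\<close>, so this sum is finite almost
  everywhere.\<close>
lemma AE_summable_of_nn_integral:
  fixes u :: "nat \<Rightarrow> 'a \<Rightarrow> complex"
  assumes [measurable]: "\<And>k. u k \<in> borel_measurable M"
    and le: "\<And>k. (\<integral>\<^sup>+t. ennreal (cmod (u k t)) \<partial>M) \<le> ennreal ((1/2) ^ k)"
  shows "AE t in M. summable (\<lambda>k. u k t)"
proof -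
  have "(\<integral>\<^sup>+t. (\<Sum>k. ennreal (cmod (u k t))) \<partial>M) = (\<Sum>k. \<integral>\<^sup>+t. ennreal (cmod (u k t)) \<partial>M)"
    by (rule nn_integral_suminf) measurable
  also have "\<dots> \<le> (\<Sum>k. ennreal ((1/2) ^ k))"
    by (intro suminf_le le) auto
  also have "\<dots> < \<infinity>"
    by (subst suminf_ennreal2) auto
  finally have "AE t in M. (\<Sum>k. ennreal (cmod (u k t))) \<noteq> \<infinity>"
    by (intro nn_integral_noteq_infinite) auto
  then show ?thesis
    by eventually_elim (rule summable_norm_cancel, rule summable_suminf_not_top, auto)
qed

text \<open>The Riesz--Fischer theorem. A subsequence whose consecutive differences have norms at most
  \<open>2\<^sup>-\<^sup>k\<close> converges pointwise almost everywhere, as its differences are summable there. Fatou's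
  lemma carries the Cauchy estimate over to the pointwise limit, which is therefore square-integrable
  and the limit of the whole sequence in norm.\<close>
instance L2 :: banach
proof
  fix X :: "nat \<Rightarrow> L2"
  assume X: "Cauchy X"
  have "\<exists>f. X n = abs_L2 f \<and> square_integrable f" for n
    by (metis L2_cases)
  then obtain f where f: "\<And>n. X n = abs_L2 (f n)" "\<And>n. square_integrable (f n)"
    by metis
  have [measurable]: "f n \<in> borel_measurable unit_leb" for n
    using f(2) by (simp add: square_integrable_def)
  have fd: "square_integrable (\<lambda>t. f m t - f n t)"
    "X m - X n = abs_L2 (\<lambda>t. f m t - f n t)" for m n
    by (simp_all add: f abs_L2_diff square_integrable_diff)
  have "\<exists>M. \<forall>m\<ge>M. \<forall>n\<ge>M. norm (X m - X n) < (1/2) ^ k" for k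
    using X by (simp add: Cauchy_def dist_norm)
  then obtain N where N: "\<And>k m n. m \<ge> N k \<Longrightarrow> n \<ge> N k \<Longrightarrow> norm (X m - X n) < (1/2) ^ k"
    by metis
  (* the partial sums make r monotone and at least N; the summand k makes it unbounded *)
  define r where "r k = (\<Sum>i\<le>k. N i) + k" for k
  have rN: "r k \<ge> N k" for k
    unfolding r_def by (meson atMost_iff finite_atMost le_refl member_le_sum trans_le_add1 zero_le)
  have r_mono: "r k \<le> r (Suc k)" for k
    by (simp add: r_def)
  have r_ge: "k \<le> r k" for k
    by (simp add: r_def)
  have "(\<integral>\<^sup>+t. ennreal (cmod (f (r (Suc k)) t - f (r k) t)) \<partial>unit_leb) \<le> ennreal ((1/2) ^ k)" for k
    using N[of k "r (Suc k)" "r k"] rN[of k] r_mono[of k] fd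
    by (intro nn_integral_norm_le) (auto simp: less_imp_le)
  then have "AE t in unit_leb. summable (\<lambda>k. f (r (Suc k)) t - f (r k) t)"
    by (intro AE_summable_of_nn_integral) auto
  then have conv: "AE t in unit_leb. convergent (\<lambda>k. f (r k) t)"
  proof eventually_elim
    case (elim t)
    then obtain s where "(\<lambda>n. \<Sum>k<n. f (r (Suc k)) t - f (r k) t) \<longlonglongrightarrow> s"
      by (auto simp: summable_def sums_def)
    then have "(\<lambda>n. f (r n) t - f (r 0) t) \<longlonglongrightarrow> s"
      by (simp only: sum_lessThan_telescope[where f = "\<lambda>k. f (r k) t"])
    from tendsto_add[OF this tendsto_const[of "f (r 0) t"]] show ?case
      by (auto simp: convergent_def)
  qed
  define g where "g t = lim (\<lambda>k. f (r k) t)" for t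
  have [measurable]: "g \<in> borel_measurable unit_leb"
    unfolding g_def by measurable
  have close: "(\<integral>\<^sup>+t. ennreal ((cmod (g t - f n t))\<^sup>2) \<partial>unit_leb) \<le> ennreal (((1/2) ^ k)\<^sup>2)"
    if "n \<ge> N k" for n k
  proof -
    have "AE t in unit_leb. ennreal ((cmod (g t - f n t))\<^sup>2) =
        liminf (\<lambda>j. ennreal ((cmod (f (r j) t - f n t))\<^sup>2))"
      using conv
    proof eventually_elim
      case (elim t)
      then have "(\<lambda>j. f (r j) t) \<longlonglongrightarrow> g t"
        by (simp add: g_def convergent_LIMSEQ_iff)
      then have "(\<lambda>j. ennreal ((cmod (f (r j) t - f n t))\<^sup>2)) \<longlonglongrightarrow> ennreal ((cmod (g t - f n t))\<^sup>2)"
        by (intro tendsto_intros)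
      then show ?case
        by (rule lim_imp_Liminf[OF trivial_limit_sequentially, symmetric])
    qed
    then have "(\<integral>\<^sup>+t. ennreal ((cmod (g t - f n t))\<^sup>2) \<partial>unit_leb) =
        (\<integral>\<^sup>+t. liminf (\<lambda>j. ennreal ((cmod (f (r j) t - f n t))\<^sup>2)) \<partial>unit_leb)"
      by (rule nn_integral_cong_AE)
    also have "\<dots> \<le> liminf (\<lambda>j. \<integral>\<^sup>+t. ennreal ((cmod (f (r j) t - f n t))\<^sup>2) \<partial>unit_leb)"
      by (rule nn_integral_liminf) measurable
    also have "\<dots> = liminf (\<lambda>j. ennreal ((norm (X (r j) - X n))\<^sup>2))"
      by (simp add: fd nn_integral_norm_abs_L2)
    also have "\<dots> \<le> limsup (\<lambda>j. ennreal ((norm (X (r j) - X n))\<^sup>2))"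
      by (simp add: Liminf_le_Limsup)
    also have "\<dots> \<le> ennreal (((1/2) ^ k)\<^sup>2)"
    proof (rule Limsup_bounded)
      have "\<forall>\<^sub>F j in sequentially. j \<ge> N k"
        by (rule eventually_ge_at_top)
      then show "\<forall>\<^sub>F j in sequentially. ennreal ((norm (X (r j) - X n))\<^sup>2) \<le> ennreal (((1/2) ^ k)\<^sup>2)"
      proof eventually_elim
        case (elim j)
        then show ?case
          using N[of k "r j" n] that r_ge[of j] by (intro ennreal_leI power_mono) auto
      qed
    qed
    finally show ?thesis .
  qed
  have gd: "square_integrable (\<lambda>t. g t - f n t)" if "n \<ge> N k" for n k
    using close[OF that] by (auto simp: square_integrable_iff_nn_integral elim: le_less_trans)
  have "square_integrable (\<lambda>t. (g t - f (N 0) t) + f (N 0) t)"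
    by (intro square_integrable_add f gd[of 0]) simp
  then have g: "square_integrable g"
    by simp
  have "norm (abs_L2 g - X n) \<le> (1/2) ^ k" if "n \<ge> N k" for n k
  proof -
    have "ennreal ((norm (abs_L2 g - X n))\<^sup>2) \<le> ennreal (((1/2) ^ k)\<^sup>2)"
      using close[OF that] gd[OF that]
      by (simp add: f abs_L2_diff g nn_integral_norm_abs_L2)
    then have "(norm (abs_L2 g - X n))\<^sup>2 \<le> ((1/2) ^ k)\<^sup>2"
      by (subst (asm) ennreal_le_iff) auto
    then show ?thesis
      by (rule power2_le_imp_le) simp
  qed
  moreover have "\<exists>k. (1/2) ^ k < e" if "e > 0" for e :: real
    using real_arch_pow_inv[of e "1/2"] that by auto
  ultimately have "X \<longlonglongrightarrow> abs_L2 g"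
    unfolding LIMSEQ_def dist_norm by (metis le_less_trans norm_minus_commute)
  then show "convergent X"
    by (auto simp: convergent_def)
qed


section \<open>Orthogonal series\<close>

lemma orthogonal_sum_norm_diff:
  fixes f :: "'i \<Rightarrow> 'a::real_inner"
  assumes orth: "pairwise (\<lambda>i j. orthogonal (f i) (f j)) I"
    and F: "finite F" "F \<subseteq> I" and "F0 \<subseteq> F"
  shows "(norm (sum f F - sum f F0))\<^sup>2 = (\<Sum>i\<in>F. (norm (f i))\<^sup>2) - (\<Sum>i\<in>F0. (norm (f i))\<^sup>2)"
proof -
  have "sum f F - sum f F0 = sum f (F - F0)"
    using F \<open>F0 \<subseteq> F\<close> by (simp add: sum_diff)
  moreover have "(norm (sum f (F - F0)))\<^sup>2 = (\<Sum>i\<in>F - F0. (norm (f i))\<^sup>2)"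
    using F by (intro norm_sum_Pythagorean pairwise_subset[OF orth]) auto
  ultimately show ?thesis
    using F \<open>F0 \<subseteq> F\<close> by (simp add: sum_diff)
qed

text \<open>By Pythagoras, once a finite set \<open>F\<^sub>0\<close> exhausts the sum of squares up to \<open>(e / 2)\<^sup>2\<close>, the
  partial sum over any larger finite set is within \<open>e / 2\<close> of the one over \<open>F\<^sub>0\<close>. Hence the net of
  partial sums is Cauchy.\<close>
lemma orthogonal_summable_on:
  fixes f :: "'i \<Rightarrow> 'a::{real_inner, banach}"
  assumes orth: "pairwise (\<lambda>i j. orthogonal (f i) (f j)) I"
    and sq: "(\<lambda>i. (norm (f i))\<^sup>2) summable_on I"
  shows "f summable_on I"
proof -
  let ?q = "\<lambda>F. \<Sum>i\<in>F. (norm (f i))\<^sup>2"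
  define S where "S = (\<Sum>\<^sub>\<infinity>i\<in>I. (norm (f i))\<^sup>2)"
  have S: "(?q \<longlongrightarrow> S) (finite_subsets_at_top I)"
    using sq has_sum_infsum unfolding S_def has_sum_def by blast
  have q_le: "?q F \<le> S" if "finite F" "F \<subseteq> I" for F
    unfolding S_def using that sq by (intro finite_sum_le_infsum) auto
  have "\<exists>P. eventually P (finite_subsets_at_top I) \<and>
      (\<forall>F G. P F \<and> P G \<longrightarrow> dist (sum f F) (sum f G) < e)" if "e > 0" for e
  proof -
    have "\<forall>\<^sub>F F in finite_subsets_at_top I. ?q F > S - (e / 2)\<^sup>2"
      using S \<open>e > 0\<close> by (intro order_tendstoD) auto
    then obtain F0 where F0: "finite F0" "F0 \<subseteq> I" "?q F0 > S - (e / 2)\<^sup>2"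
      unfolding eventually_finite_subsets_at_top by blast
    define P where "P F \<longleftrightarrow> finite F \<and> F0 \<subseteq> F \<and> F \<subseteq> I" for F
    have near: "norm (sum f F - sum f F0) < e / 2" if "P F" for F
    proof (rule power2_less_imp_less)
      have "?q F - ?q F0 < (e / 2)\<^sup>2"
        using q_le[of F] F0(3) that by (simp add: P_def)
      then show "(norm (sum f F - sum f F0))\<^sup>2 < (e / 2)\<^sup>2"
        using orthogonal_sum_norm_diff[OF orth, of F F0] that by (simp add: P_def)
    qed (use \<open>e > 0\<close> in simp)
    have "dist (sum f F) (sum f G) < e" if "P F" "P G" for F G
      using near[OF that(1)] near[OF that(2)] norm_triangle_ineq4[of "sum f F - sum f F0" "sum f G - sum f F0"]
      by (simp add: dist_norm)
    moreover have "eventually P (finite_subsets_at_top I)"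
      unfolding eventually_finite_subsets_at_top P_def using F0 by blast
    ultimately show ?thesis
      by blast
  qed
  then have "cauchy_filter (filtermap (sum f) (finite_subsets_at_top I))"
    by (simp add: cauchy_filter_metric_filtermap)
  moreover have "complete (UNIV :: 'a set)"
    by (meson Cauchy_convergent UNIV_I complete_def convergent_def)
  ultimately obtain x where "(sum f \<longlongrightarrow> x) (finite_subsets_at_top I)"
    using cauchy_filter_complete_converges[of "filtermap (sum f) (finite_subsets_at_top I)" UNIV]
    by (auto simp: filterlim_def filtermap_bot_iff)
  then show ?thesis
    by (auto simp: summable_on_def has_sum_def)
qed

lemma norm_infsum_orthogonal:
  fixes f :: "'i \<Rightarrow> 'a::{real_inner, banach}"
  assumes orth: "pairwise (\<lambda>i j. orthogonal (f i) (f j)) I"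
    and sq: "(\<lambda>i. (norm (f i))\<^sup>2) summable_on I"
  shows "(norm (\<Sum>\<^sub>\<infinity>i\<in>I. f i))\<^sup>2 = (\<Sum>\<^sub>\<infinity>i\<in>I. (norm (f i))\<^sup>2)"
proof -
  have "((\<lambda>F. (norm (sum f F))\<^sup>2) \<longlongrightarrow> (norm (infsum f I))\<^sup>2) (finite_subsets_at_top I)"
    using has_sum_infsum[OF orthogonal_summable_on[OF assms]]
    by (intro tendsto_intros) (simp add: has_sum_def)
  moreover have "\<forall>\<^sub>F F in finite_subsets_at_top I. (norm (sum f F))\<^sup>2 = (\<Sum>i\<in>F. (norm (f i))\<^sup>2)"
    by (rule eventually_finite_subsets_at_top_weakI)
       (intro norm_sum_Pythagorean pairwise_subset[OF orth])
  ultimately have "((\<lambda>F. \<Sum>i\<in>F. (norm (f i))\<^sup>2) \<longlongrightarrow> (norm (infsum f I))\<^sup>2) (finite_subsets_at_top I)"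
    by (rule Lim_transform_eventually)
  moreover have "((\<lambda>F. \<Sum>i\<in>F. (norm (f i))\<^sup>2) \<longlongrightarrow> (\<Sum>\<^sub>\<infinity>i\<in>I. (norm (f i))\<^sup>2)) (finite_subsets_at_top I)"
    using has_sum_infsum[OF sq] by (simp add: has_sum_def)
  ultimately show ?thesis
    by (intro tendsto_unique[OF finite_subsets_at_top_neq_bot])
qed

section \<open>The exponentials\<close>

lemma norm_scaleC: "norm (c *\<^sub>C f) = cmod c * norm f"
proof transfer
  fix c :: complex and f
  have "(\<integral>t. (cmod (c * f t))\<^sup>2 \<partial>unit_leb) = (cmod c)\<^sup>2 * (\<integral>t. (cmod (f t))\<^sup>2 \<partial>unit_leb)"
    by (simp add: norm_mult power_mult_distrib)
  then show "sqrt (\<integral>t. (cmod (c * f t))\<^sup>2 \<partial>unit_leb) = cmod c * sqrt (\<integral>t. (cmod (f t))\<^sup>2 \<partial>unit_leb)"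
    by (simp add: real_sqrt_mult)
qed

lemma integral_exponential:
  fixes k :: int
  assumes "k \<noteq> 0"
  shows "(\<integral>t. exp (2 * of_real pi * \<i> * of_int k * of_real t) \<partial>unit_leb) = (0 :: complex)"
proof -
  define c where "c = 2 * complex_of_real pi * \<i> * of_int k"
  have "c \<noteq> 0"
    using assms by (simp add: c_def)
  have "continuous_on {0..1} (\<lambda>t::real. exp (c * of_real t))"
    by (intro continuous_intros)
  then have int: "integrable unit_leb (\<lambda>t. exp (c * of_real t))"
    by (rule continuous_imp_integrable_real)
  have "((\<lambda>t::real. exp (c * of_real t)) has_integral exp (c * of_real 1) / c - exp (c * of_real 0) / c) {0..1}"
  proof (rule fundamental_theorem_of_calculus)
    fix t :: real
    have "((\<lambda>z. exp (c * z) / c) has_field_derivative exp (c * of_real t)) (at (of_real t))"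
      using \<open>c \<noteq> 0\<close> by (auto intro!: derivative_eq_intros)
    then show "((\<lambda>t. exp (c * of_real t) / c) has_vector_derivative exp (c * of_real t)) (at t within {0..1})"
      by (rule has_vector_derivative_real_field)
  qed simp
  moreover have "exp c = 1"
    unfolding c_def exp_eq_1 by (auto simp: mult_ac)
  ultimately have "integral {0..1} (\<lambda>t::real. exp (c * of_real t)) = 0"
    by (simp add: integral_unique)
  then show ?thesis
    using int by (simp add: lebesgue_integral_eq_integral c_def)
qed

text \<open>Orthogonality is with respect to the real inner product \<open>Re \<integral> f cnj g\<close>. The arbitrary complex
  coefficients make it equivalent to orthogonality in the complex sense, and allow the real theorems
  on orthogonal series to be applied to complex linear combinations.\<close>
lemma orthogonal_expo:
  assumes "m \<noteq> n"
  shows "orthogonal (a *\<^sub>C expo m) (b *\<^sub>C expo n)"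
  using assms unfolding orthogonal_def
proof transfer
  fix m n :: int and a b :: complex
  assume "m \<noteq> n"
  let ?e = "\<lambda>n t. exp (2 * of_real pi * \<i> * of_int n * of_real t)"
  have "a * ?e m t * cnj (b * ?e n t) = a * cnj b * ?e (m - n) t" for t
  proof -
    have "?e m t * cnj (?e n t) = ?e (m - n) t"
      by (simp add: exp_cnj algebra_simps flip: exp_add)
    then show ?thesis
      by (simp add: mult_ac)
  qed
  then have "(\<integral>t. a * ?e m t * cnj (b * ?e n t) \<partial>unit_leb) = (\<integral>t. a * cnj b * ?e (m - n) t \<partial>unit_leb)"
    by (rule Bochner_Integration.integral_cong[OF refl])
  also have "\<dots> = a * cnj b * (\<integral>t. ?e (m - n) t \<partial>unit_leb)"
    by (rule integral_mult_right_zero)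
  also have "\<dots> = 0"
    using integral_exponential[of "m - n"] \<open>m \<noteq> n\<close> by simp
  finally show "Re (\<integral>t. a * ?e m t * cnj (b * ?e n t) \<partial>unit_leb) = 0"
    by simp
qed

lemma norm_expo: "norm (expo n) = 1"
proof transfer
  fix n :: int
  have "measure unit_leb {0..1} = 1"
    by (simp add: measure_restrict_space)
  then show "sqrt (\<integral>t. (cmod (exp (2 * of_real pi * \<i> * of_int n * of_real t)))\<^sup>2 \<partial>unit_leb) = 1"
    by (simp add: norm_exp_eq_Re)
qed

lemma expo_series:
  assumes "(\<lambda>n. (cmod (a n))\<^sup>2) summable_on I"
  shows "(\<lambda>n. a n *\<^sub>C expo n) summable_on I"
    and "(norm (\<Sum>\<^sub>\<infinity>n\<in>I. a n *\<^sub>C expo n))\<^sup>2 = (\<Sum>\<^sub>\<infinity>n\<in>I. (cmod (a n))\<^sup>2)"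
proof -
  have orth: "pairwise (\<lambda>m n. orthogonal (a m *\<^sub>C expo m) (a n *\<^sub>C expo n)) I"
    by (simp add: pairwise_def orthogonal_expo)
  have norm: "norm (a n *\<^sub>C expo n) = cmod (a n)" for n
    by (simp add: norm_scaleC norm_expo)
  show "(\<lambda>n. a n *\<^sub>C expo n) summable_on I"
    using orthogonal_summable_on[OF orth] assms by (simp add: norm)
  show "(norm (\<Sum>\<^sub>\<infinity>n\<in>I. a n *\<^sub>C expo n))\<^sup>2 = (\<Sum>\<^sub>\<infinity>n\<in>I. (cmod (a n))\<^sup>2)"
    using norm_infsum_orthogonal[OF orth] assms by (simp add: norm)
qed

lemma span_expoE:
  assumes "f \<in> L2.span (expo ` I)"
  obtains F a where "finite F" "F \<subseteq> I" "f = (\<Sum>n\<in>F. a n *\<^sub>C expo n)"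
proof -
  obtain T r where T: "finite T" "T \<subseteq> expo ` I" "f = (\<Sum>x\<in>T. r x *\<^sub>C x)"
    using assms unfolding L2.span_explicit mem_Collect_eq by (elim exE conjE)
  from T(2) obtain F where F: "F \<subseteq> I" "inj_on expo F" "T = expo ` F"
    unfolding subset_image_inj by (elim exE conjE)
  show thesis
  proof
    show "finite F"
      using T F by (simp add: finite_image_iff)
    show "f = (\<Sum>n\<in>F. r (expo n) *\<^sub>C expo n)"
      using T F by (simp add: sum.reindex)
  qed (fact F)
qed

lemma infsum_expo_in_exp_space:
  assumes "(\<lambda>n. a n *\<^sub>C expo n) summable_on I"
  shows "(\<Sum>\<^sub>\<infinity>n\<in>I. a n *\<^sub>C expo n) \<in> exp_space I"
proof (rule Lim_in_closed_set)
  show "closed (exp_space I)"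
    by (simp add: exp_space_def)
  show "(sum (\<lambda>n. a n *\<^sub>C expo n) \<longlongrightarrow> (\<Sum>\<^sub>\<infinity>n\<in>I. a n *\<^sub>C expo n)) (finite_subsets_at_top I)"
    using has_sum_infsum[OF assms] by (simp add: has_sum_def)
  show "\<forall>\<^sub>F F in finite_subsets_at_top I. (\<Sum>n\<in>F. a n *\<^sub>C expo n) \<in> exp_space I"
  proof (rule eventually_finite_subsets_at_top_weakI)
    fix F assume "finite F" "F \<subseteq> I"
    then have "(\<Sum>n\<in>F. a n *\<^sub>C expo n) \<in> L2.span (expo ` I)"
      by (intro L2.span_sum L2.span_scale L2.span_base) auto
    then show "(\<Sum>n\<in>F. a n *\<^sub>C expo n) \<in> exp_space I"
      unfolding exp_space_def using closure_subset by blast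
  qed
qed simp

section \<open>Toeplitz operators as bounded operators\<close>

lemma toeplitz_add: "toeplitz \<phi> (f + g) = toeplitz \<phi> f + toeplitz \<phi> g"
proof transfer
  fix \<phi> f g assume "L2_rel f f" "L2_rel g g"
  then show "L2_rel (\<lambda>t. if \<phi> \<in> Linf then (f t + g t) * \<phi> t else 0)
      (\<lambda>t. (if \<phi> \<in> Linf then f t * \<phi> t else 0) + (if \<phi> \<in> Linf then g t * \<phi> t else 0))"
    by (cases "\<phi> \<in> Linf")
       (simp_all add: L2_rel_refl_iff distrib_right square_integrable_add
          square_integrable_Linf_mult square_integrable_zero)
qed

lemma toeplitz_scaleC: "toeplitz \<phi> (c *\<^sub>C f) = c *\<^sub>C toeplitz \<phi> f"
proof transfer
  fix \<phi> c f assume "L2_rel f f"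
  then show "L2_rel (\<lambda>t. if \<phi> \<in> Linf then c * f t * \<phi> t else 0)
      (\<lambda>t. c * (if \<phi> \<in> Linf then f t * \<phi> t else 0))"
    by (cases "\<phi> \<in> Linf")
       (simp_all add: L2_rel_refl_iff mult.assoc square_integrable_mult_const
          square_integrable_Linf_mult square_integrable_zero)
qed

lemma scaleC_of_real: "of_real r *\<^sub>C f = r *\<^sub>R f"
  by transfer (simp add: L2_rel_refl_iff square_integrable_mult_const)

lemma norm_abs_L2_le:
  assumes f: "square_integrable f" and g: "square_integrable g"
    and le: "AE t in unit_leb. cmod (f t) \<le> C * cmod (g t)" and "0 \<le> C"
  shows "norm (abs_L2 f) \<le> C * norm (abs_L2 g)"
proof (rule power2_le_imp_le)
  have "(norm (abs_L2 f))\<^sup>2 = (\<integral>t. (cmod (f t))\<^sup>2 \<partial>unit_leb)"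
    using f by (rule norm_abs_L2)
  also have "\<dots> \<le> (\<integral>t. C\<^sup>2 * (cmod (g t))\<^sup>2 \<partial>unit_leb)"
  proof (rule integral_mono_AE)
    show "AE t in unit_leb. (cmod (f t))\<^sup>2 \<le> C\<^sup>2 * (cmod (g t))\<^sup>2"
      using le
    proof eventually_elim
      case (elim t)
      then have "(cmod (f t))\<^sup>2 \<le> (C * cmod (g t))\<^sup>2"
        by (rule power_mono) simp
      then show ?case
        by (simp add: power_mult_distrib)
    qed
  qed (use f g in \<open>auto simp: square_integrable_def\<close>)
  also have "\<dots> = (C * norm (abs_L2 g))\<^sup>2"
    using g by (simp add: norm_abs_L2 power_mult_distrib)
  finally show "(norm (abs_L2 f))\<^sup>2 \<le> (C * norm (abs_L2 g))\<^sup>2" .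
qed (use \<open>0 \<le> C\<close> in simp)

lemma norm_toeplitz_le:
  assumes "\<phi> \<in> Linf" "\<psi> \<in> Linf"
    and le: "AE t in unit_leb. cmod (\<phi> t) \<le> C * cmod (\<psi> t)" and "0 \<le> C"
  shows "norm (toeplitz \<phi> f) \<le> C * norm (toeplitz \<psi> f)"
proof -
  obtain u where u: "f = abs_L2 u" "square_integrable u"
    by (rule L2_cases)
  have "AE t in unit_leb. cmod (u t * \<phi> t) \<le> C * cmod (u t * \<psi> t)"
    using le
  proof eventually_elim
    case (elim t)
    then show ?case
      using mult_left_mono[OF elim norm_ge_zero[of "u t"]] by (simp add: norm_mult mult_ac)
  qed
  then have "norm (abs_L2 (\<lambda>t. u t * \<phi> t)) \<le> C * norm (abs_L2 (\<lambda>t. u t * \<psi> t))"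
    using assms u by (intro norm_abs_L2_le square_integrable_Linf_mult)
  then show ?thesis
    using assms u by (simp add: toeplitz.abs_eq L2_rel_refl_iff)
qed

text \<open>Comparison of \<open>\<phi>\<close> with the constant symbol \<open>1\<close>, whose operator is the identity.\<close>
lemma toeplitz_bounded:
  assumes "\<phi> \<in> Linf"
  shows "\<exists>C. \<forall>f. norm (toeplitz \<phi> f) \<le> C * norm f"
proof -
  obtain C where C: "AE t in unit_leb. cmod (\<phi> t) \<le> C"
    using assms by (auto simp: Linf_def)
  have one: "(\<lambda>t. 1) \<in> Linf"
    by (auto simp: Linf_def)
  then have "toeplitz (\<lambda>t. 1) f = f" for f
    by transfer (simp add: L2_rel_refl_iff)
  moreover have "AE t in unit_leb. cmod (\<phi> t) \<le> max 0 C * cmod 1"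
    using C by eventually_elim auto
  then have "norm (toeplitz \<phi> f) \<le> max 0 C * norm (toeplitz (\<lambda>t. 1) f)" for f
    using assms one by (intro norm_toeplitz_le) auto
  ultimately show ?thesis
    by auto
qed

lemma bounded_linear_toeplitz:
  assumes "\<phi> \<in> Linf"
  shows "bounded_linear (toeplitz \<phi>)"
proof -
  obtain C where "\<And>f. norm (toeplitz \<phi> f) \<le> C * norm f"
    using toeplitz_bounded[OF assms] by blast
  then show ?thesis
    by (intro bounded_linear_intro[where K = C])
       (simp_all add: toeplitz_add toeplitz_scaleC mult.commute flip: scaleC_of_real)
qed

section \<open>Riesz basic sequences and lower bounds\<close>

definition bounded_below_on :: "L2 set \<Rightarrow> (L2 \<Rightarrow> L2) \<Rightarrow> bool" where
  "bounded_below_on V T \<longleftrightarrow> (\<exists>c>0. \<forall>f\<in>V. c * norm f \<le> norm (T f))"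

lemma isomorphism_onto_range_toeplitz_iff:
  assumes "\<phi> \<in> Linf"
  shows "isomorphism_onto_range V (toeplitz \<phi>) \<longleftrightarrow> bounded_below_on V (toeplitz \<phi>)"
proof -
  obtain C where "\<forall>f. norm (toeplitz \<phi> f) \<le> C * norm f"
    using toeplitz_bounded[OF assms] ..
  then have "\<exists>C. \<forall>f\<in>V. norm (toeplitz \<phi> f) \<le> C * norm f"
    by (intro exI[of _ C]) simp
  then show ?thesis
    by (simp add: isomorphism_onto_range_def bounded_below_on_def toeplitz_add toeplitz_scaleC)
qed

text \<open>For a finite combination \<open>f\<close> of the exponentials, the lower Riesz inequality with constant
  \<open>A\<close> reads \<open>A \<parallel>f\<parallel>\<^sup>2 \<le> \<parallel>T\<^sub>\<phi> f\<parallel>\<^sup>2\<close>; both sides are continuous in \<open>f\<close>, so the inequality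
  extends to the closed span.\<close>
lemma riesz_basic_sequence_toeplitz_imp_bounded_below:
  assumes \<phi>: "\<phi> \<in> Linf" and riesz: "riesz_basic_sequence I (\<lambda>n. toeplitz \<phi> (expo n))"
  shows "bounded_below_on (exp_space I) (toeplitz \<phi>)"
proof -
  interpret T: bounded_linear "toeplitz \<phi>"
    using \<phi> by (rule bounded_linear_toeplitz)
  obtain A where "A > 0" and A: "\<And>a :: int \<Rightarrow> complex. (\<lambda>n. (cmod (a n))\<^sup>2) summable_on I \<Longrightarrow>
      A * (\<Sum>\<^sub>\<infinity>n\<in>I. (cmod (a n))\<^sup>2) \<le> (norm (\<Sum>\<^sub>\<infinity>n\<in>I. a n *\<^sub>C toeplitz \<phi> (expo n)))\<^sup>2"
    using riesz unfolding riesz_basic_sequence_def by (elim exE conjE) simp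
  let ?V = "{f. sqrt A * norm f \<le> norm (toeplitz \<phi> f)}"
  have span: "f \<in> ?V" if "f \<in> L2.span (expo ` I)" for f
  proof -
    obtain F a where F: "finite F" "F \<subseteq> I" "f = (\<Sum>n\<in>F. a n *\<^sub>C expo n)"
      using \<open>f \<in> L2.span (expo ` I)\<close> by (rule span_expoE)
    define b where "b n = (if n \<in> F then a n else 0)" for n
    have summable: "(\<lambda>n. (cmod (b n))\<^sup>2) summable_on I"
      by (rule finite_nonzero_values_imp_summable_on, rule finite_subset[OF _ F(1)])
        (auto simp: b_def)
    have collapse: "(\<Sum>\<^sub>\<infinity>n\<in>I. b n *\<^sub>C g n) = (\<Sum>n\<in>F. a n *\<^sub>C g n)" for g
    proof -
      have "(\<Sum>\<^sub>\<infinity>n\<in>I. b n *\<^sub>C g n) = (\<Sum>\<^sub>\<infinity>n\<in>F. a n *\<^sub>C g n)"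
        using F by (intro infsum_cong_neutral) (auto simp: b_def)
      then show ?thesis
        using F by simp
    qed
    have "(sqrt A * norm f)\<^sup>2 = A * (norm f)\<^sup>2"
      using \<open>A > 0\<close> by (simp add: power_mult_distrib)
    also have "\<dots> = A * (\<Sum>\<^sub>\<infinity>n\<in>I. (cmod (b n))\<^sup>2)"
      using expo_series(2)[OF summable] F by (simp add: collapse)
    also have "\<dots> \<le> (norm (\<Sum>n\<in>F. a n *\<^sub>C toeplitz \<phi> (expo n)))\<^sup>2"
      using A[OF summable] by (simp add: collapse)
    also have "\<dots> = (norm (toeplitz \<phi> f))\<^sup>2"
      using F by (simp add: T.sum toeplitz_scaleC)
    finally have "sqrt A * norm f \<le> norm (toeplitz \<phi> f)"
      by (rule power2_le_imp_le) simp
    then show ?thesis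
      by simp
  qed
  have "closed ?V"
    by (intro closed_Collect_le continuous_on_mult continuous_on_const continuous_on_norm
        continuous_on_id T.continuous_on)
  then have "exp_space I \<subseteq> ?V"
    unfolding exp_space_def using span by (intro closure_minimal subsetI)
  then have "sqrt A > 0 \<and> (\<forall>f\<in>exp_space I. sqrt A * norm f \<le> norm (toeplitz \<phi> f))"
    using \<open>A > 0\<close> by (simp add: subset_iff)
  then show ?thesis
    unfolding bounded_below_on_def ..
qed

text \<open>Here completeness enters: for square-summable coefficients the series \<open>\<Sum> a\<^sub>n e\<^sub>n\<close>
  has a sum in \<open>S(I)\<close>, on which the lower bound is available.\<close>
lemma bounded_below_imp_riesz_basic_sequence_toeplitz:
  assumes \<phi>: "\<phi> \<in> Linf" and below: "bounded_below_on (exp_space I) (toeplitz \<phi>)"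
  shows "riesz_basic_sequence I (\<lambda>n. toeplitz \<phi> (expo n))"
proof -
  have lin: "bounded_linear (toeplitz \<phi>)"
    using \<phi> by (rule bounded_linear_toeplitz)
  obtain C where "C > 0" and C: "\<And>f. norm (toeplitz \<phi> f) \<le> norm f * C"
    using bounded_linear.pos_bounded[OF lin] by blast
  obtain c where "c > 0" and c: "\<And>f. f \<in> exp_space I \<Longrightarrow> c * norm f \<le> norm (toeplitz \<phi> f)"
    using below unfolding bounded_below_on_def by blast
  show ?thesis
    unfolding riesz_basic_sequence_def
  proof (rule exI[of _ "c\<^sup>2"], rule conjI, use \<open>c > 0\<close> in simp,
      rule exI[of _ "C\<^sup>2"], rule conjI, use \<open>C > 0\<close> in simp, intro allI impI)
    fix a :: "int \<Rightarrow> complex"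
    assume a: "(\<lambda>n. (cmod (a n))\<^sup>2) summable_on I"
    define x where "x = (\<Sum>\<^sub>\<infinity>n\<in>I. a n *\<^sub>C expo n)"
    note series = expo_series[OF a]
    have "((\<lambda>n. a n *\<^sub>C toeplitz \<phi> (expo n)) has_sum toeplitz \<phi> x) I"
      using has_sum_bounded_linear[OF lin has_sum_infsum[OF series(1)]]
      by (simp add: toeplitz_scaleC x_def o_def)
    then have "(\<lambda>n. a n *\<^sub>C toeplitz \<phi> (expo n)) summable_on I"
      and "(\<Sum>\<^sub>\<infinity>n\<in>I. a n *\<^sub>C toeplitz \<phi> (expo n)) = toeplitz \<phi> x"
      by (auto simp: summable_on_def infsumI)
    moreover have "(c * norm x)\<^sup>2 \<le> (norm (toeplitz \<phi> x))\<^sup>2"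
      using c[of x] infsum_expo_in_exp_space[OF series(1)] \<open>c > 0\<close>
      by (intro power_mono) (auto simp: x_def)
    moreover have "(norm (toeplitz \<phi> x))\<^sup>2 \<le> (norm x * C)\<^sup>2"
      by (intro power_mono C) simp
    ultimately show "(\<lambda>n. a n *\<^sub>C toeplitz \<phi> (expo n)) summable_on I \<and>
      c\<^sup>2 * (\<Sum>\<^sub>\<infinity>n\<in>I. (cmod (a n))\<^sup>2) \<le> (norm (\<Sum>\<^sub>\<infinity>n\<in>I. a n *\<^sub>C toeplitz \<phi> (expo n)))\<^sup>2 \<and>
      (norm (\<Sum>\<^sub>\<infinity>n\<in>I. a n *\<^sub>C toeplitz \<phi> (expo n)))\<^sup>2 \<le> C\<^sup>2 * (\<Sum>\<^sub>\<infinity>n\<in>I. (cmod (a n))\<^sup>2)"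
      using series(2) by (simp add: power_mult_distrib mult.commute x_def)
  qed
qed

lemma feichtinger_toeplitz_iff:
  assumes "\<phi> \<in> Linf"
  shows "feichtinger (toeplitz \<phi>) \<longleftrightarrow> (\<exists>\<A>. finite \<A> \<and> partition_on (UNIV :: int set) \<A> \<and>
           (\<forall>A\<in>\<A>. bounded_below_on (exp_space A) (toeplitz \<phi>)))"
proof -
  have "riesz_basic_sequence A (\<lambda>n. toeplitz \<phi> (expo n)) \<longleftrightarrow>
      bounded_below_on (exp_space A) (toeplitz \<phi>)" for A
    using riesz_basic_sequence_toeplitz_imp_bounded_below[OF assms, of A]
      bounded_below_imp_riesz_basic_sequence_toeplitz[OF assms, of A] by (rule iffI)
  then show ?thesis
    by (simp add: feichtinger_def)
qed

text \<open>If \<open>\<bar>\<psi>\<bar> \<le> C \<bar>\<phi>\<bar>\<close>, then \<open>\<parallel>T\<^sub>\<psi> f\<parallel> \<le> C \<parallel>T\<^sub>\<phi> f\<parallel>\<close>, so a lower bound for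
  \<open>T\<^sub>\<psi>\<close> on a space gives one for \<open>T\<^sub>\<phi>\<close> on the same space; the partition need not change.\<close>
lemma feichtinger_toeplitz_mono:
  assumes "\<phi> \<in> Linf" "\<psi> \<in> Linf" "C > 0"
    and "AE t in unit_leb. cmod (\<psi> t) \<le> C * cmod (\<phi> t)"
    and "feichtinger (toeplitz \<psi>)"
  shows "feichtinger (toeplitz \<phi>)"
proof -
  have "bounded_below_on V (toeplitz \<phi>)" if below: "bounded_below_on V (toeplitz \<psi>)" for V
  proof -
    obtain c where "c > 0" and c: "\<And>f. f \<in> V \<Longrightarrow> c * norm f \<le> norm (toeplitz \<psi> f)"
      using below unfolding bounded_below_on_def by blast
    have "c / C * norm f \<le> norm (toeplitz \<phi> f)" if "f \<in> V" for f
      using c[OF that] norm_toeplitz_le[of \<psi> \<phi> C f] assms by (simp add: field_simps)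
    then show ?thesis
      unfolding bounded_below_on_def using \<open>c > 0\<close> \<open>C > 0\<close>
      by (intro exI[of _ "c / C"]) auto
  qed
  then show ?thesis
    using assms(5) unfolding feichtinger_toeplitz_iff[OF assms(1)] feichtinger_toeplitz_iff[OF assms(2)]
    by blast
qed

section \<open>Indicator symbols and level sets\<close>

lemma indicator_Linf:
  assumes "E \<in> sets lebesgue"
  shows "indicator E \<in> Linf"
proof -
  have "E \<inter> {0..1} \<in> sets unit_leb"
    using assms by (auto simp: sets_restrict_space)
  then have "(indicator E :: real \<Rightarrow> complex) \<in> borel_measurable unit_leb"
    by (simp add: borel_measurable_indicator_iff)
  moreover have "AE t in unit_leb. cmod (indicator E t) \<le> 1"
    by (simp add: indicator_def)
  ultimately show ?thesis
    by (auto simp: Linf_def)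
qed

lemma AE_indicator_zero_imp_null:
  assumes "E \<in> sets lebesgue" "E \<subseteq> {0..1}" and "AE t in unit_leb. indicator E t = (0 :: complex)"
  shows "measure lebesgue E = 0"
proof -
  have "E \<in> sets unit_leb"
    using assms by (auto simp: sets_restrict_space)
  moreover have "AE t in unit_leb. t \<notin> E"
    using assms(3) by eventually_elim (auto simp: indicator_def split: if_splits)
  ultimately have "E \<in> null_sets unit_leb"
    by (simp add: AE_iff_null_sets)
  then have "emeasure unit_leb E = 0"
    by (simp add: null_sets_def)
  then show ?thesis
    using assms by (simp add: emeasure_restrict_space measure_def)
qed

text \<open>The set where \<open>\<phi>\<close> does not vanish is the union of the countably many level sets
  \<open>\<bar>\<phi>\<bar> \<ge> 1 / (n + 1)\<close>; if all of these were null, so would be the union.\<close>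
lemma essentially_nonzero_superlevel_set:
  assumes \<phi>: "\<phi> \<in> borel_measurable unit_leb" and "\<not> (AE t in unit_leb. \<phi> t = 0)"
  obtains \<epsilon> where "\<epsilon> > 0" "{t \<in> {0..1}. \<epsilon> \<le> cmod (\<phi> t)} \<in> sets lebesgue"
    "0 < measure lebesgue {t \<in> {0..1}. \<epsilon> \<le> cmod (\<phi> t)}"
proof -
  define E where "E n = {t \<in> {0..1}. inverse (real (Suc n)) \<le> cmod (\<phi> t)}" for n
  have E_unit: "E n \<in> sets unit_leb" for n
  proof -
    have "{t \<in> space unit_leb. inverse (real (Suc n)) \<le> cmod (\<phi> t)} \<in> sets unit_leb"
      using \<phi> by measurable
    then show ?thesis
      by (simp add: E_def)
  qed
  have E_leb: "E n \<in> sets lebesgue" for n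
    using E_unit[of n] by (simp add: sets_restrict_space_iff)
  have E_sub: "E n \<subseteq> {0..1}" for n
    by (auto simp: E_def)
  have "\<exists>n. 0 < measure lebesgue (E n)"
  proof (rule ccontr)
    assume "\<nexists>n. 0 < measure lebesgue (E n)"
    then have zero: "measure lebesgue (E n) = 0" for n
      by (simp add: zero_less_measure_iff)
    have "AE t in unit_leb. t \<notin> E n" for n
    proof (rule AE_not_in)
      have "E n \<in> lmeasurable"
        using E_leb E_sub by (intro bounded_set_imp_lmeasurable bounded_subset[OF bounded_closed_interval])
      then have "emeasure lebesgue (E n) = 0"
        using zero by (simp add: emeasure_eq_measure2)
      then have "emeasure unit_leb (E n) = 0"
        using E_sub by (simp add: emeasure_restrict_space)
      then show "E n \<in> null_sets unit_leb"
        using E_unit by (simp add: null_sets_def)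
    qed
    then have "AE t in unit_leb. \<forall>n. t \<notin> E n"
      by (simp add: AE_all_countable)
    then have "AE t in unit_leb. \<phi> t = 0"
    proof (rule AE_mp, intro AE_I2 impI)
      fix t assume t: "t \<in> space unit_leb" "\<forall>n. t \<notin> E n"
      show "\<phi> t = 0"
      proof (rule ccontr)
        assume "\<phi> t \<noteq> 0"
        then obtain n where "inverse (real (Suc n)) < cmod (\<phi> t)"
          using reals_Archimedean[of "cmod (\<phi> t)"] by auto
        then have "t \<in> E n"
          using t(1) by (simp add: E_def less_imp_le del: of_nat_Suc)
        then show False
          using t(2) by blast
      qed
    qed
    with assms(2) show False by blast
  qed
  then obtain n where "0 < measure lebesgue (E n)" ..
  then show thesis
    using E_leb[of n] by (intro that[of "inverse (real (Suc n))"]) (auto simp: E_def)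
qed

lemma feichtinger_of_superlevel_set:
  assumes "\<phi> \<in> Linf" "\<epsilon> > 0" and E: "{t \<in> {0..1}. \<epsilon> \<le> cmod (\<phi> t)} \<in> sets lebesgue"
    and "feichtinger (proj {t \<in> {0..1}. \<epsilon> \<le> cmod (\<phi> t)})"
  shows "feichtinger (toeplitz \<phi>)"
proof (rule feichtinger_toeplitz_mono)
  show "AE t in unit_leb. cmod (indicator {t \<in> {0..1}. \<epsilon> \<le> cmod (\<phi> t)} t) \<le> inverse \<epsilon> * cmod (\<phi> t)"
    using \<open>\<epsilon> > 0\<close> by (auto simp: indicator_def field_simps)
qed (use assms indicator_Linf[OF E] in \<open>auto simp: proj_def\<close>)

section \<open>The equivalence\<close>

theorem theorem6p10:
  shows "((\<forall>\<phi>\<in>Linf. \<not> (AE t in unit_leb. \<phi> t = 0) \<longrightarrow> feichtinger (toeplitz \<phi>)) \<longleftrightarrow>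
          (\<forall>E. E \<in> sets lebesgue \<and> E \<subseteq> {0..1} \<and> 0 < measure lebesgue E \<longrightarrow> feichtinger (proj E)))
       \<and> ((\<forall>E. E \<in> sets lebesgue \<and> E \<subseteq> {0..1} \<and> 0 < measure lebesgue E \<longrightarrow> feichtinger (proj E)) \<longleftrightarrow>
          (\<forall>E. E \<in> sets lebesgue \<and> E \<subseteq> {0..1} \<and> 0 < measure lebesgue E \<longrightarrow>
             (\<exists>\<A>. finite \<A> \<and> partition_on (UNIV :: int set) \<A> \<and>
                (\<forall>A\<in>\<A>. isomorphism_onto_range (exp_space A) (proj E)))))"
    (is "(?toeplitz \<longleftrightarrow> ?proj) \<and> (?proj \<longleftrightarrow> ?iso)")
proof (intro conjI iffI)
  assume T: ?toeplitz
  show ?proj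
  proof (intro allI impI)
    fix E :: "real set"
    assume E: "E \<in> sets lebesgue \<and> E \<subseteq> {0..1} \<and> 0 < measure lebesgue E"
    then have "\<not> (AE t in unit_leb. indicator E t = (0 :: complex))"
      using AE_indicator_zero_imp_null[of E] by auto
    then show "feichtinger (proj E)"
      using T indicator_Linf E by (simp add: proj_def)
  qed
next
  assume P: ?proj
  show ?toeplitz
  proof (intro ballI impI)
    fix \<phi> assume \<phi>: "\<phi> \<in> Linf" and nonzero: "\<not> (AE t in unit_leb. \<phi> t = 0)"
    have "\<phi> \<in> borel_measurable unit_leb"
      using \<phi> by (simp add: Linf_def)
    then obtain \<epsilon> where "\<epsilon> > 0" and E: "{t \<in> {0..1}. \<epsilon> \<le> cmod (\<phi> t)} \<in> sets lebesgue"
      "0 < measure lebesgue {t \<in> {0..1}. \<epsilon> \<le> cmod (\<phi> t)}"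
      using essentially_nonzero_superlevel_set nonzero by blast
    have "{t \<in> {0..1}. \<epsilon> \<le> cmod (\<phi> t)} \<subseteq> {0..1}"
      by blast
    then have "feichtinger (proj {t \<in> {0..1}. \<epsilon> \<le> cmod (\<phi> t)})"
      using P E by blast
    then show "feichtinger (toeplitz \<phi>)"
      by (rule feichtinger_of_superlevel_set[OF \<phi> \<open>\<epsilon> > 0\<close> E(1)])
  qed
next
  assume ?proj
  then show ?iso
    by (simp add: proj_def feichtinger_toeplitz_iff isomorphism_onto_range_toeplitz_iff indicator_Linf)
next
  assume ?iso
  then show ?proj
    by (simp add: proj_def feichtinger_toeplitz_iff isomorphism_onto_range_toeplitz_iff indicator_Linf)
qed

end
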